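(* Let $W_\omega$ be a non-flat subnormal unilateral weighted shift with Berger measure $\sigma$, let $c:=\|W_\omega\|^2$, let $f(r):=(r,c-r)$ for $r\in[0,c]$, and let $\mu:=\sigma\circ f^{-1}$. Then the $2$-variable weighted shift $\mathcal{PE}(\omega;f)$ is a spherically quasinormal embedding of $W_\omega$; that is, $\mathcal{PE}(\omega;f)$ is a spherically quasinormal $2$-variable weighted shift.
   Context: $\mathbb{Z}_+=\{0,1,2,\dots\}$ and $\mathbb{R}_+=[0,\infty)$. A unilateral weighted shift $W_\omega$ with bounded positive weights $\omega=\{\omega_n\}_{n\ge0}$ acts on $\ell^2(\mathbb{Z}_+)$ by $W_\omega e_n=\omega_ne_{n+1}$; its moments are $\gamma_0=1$, $\gamma_k=\omega_0^2\cdots\omega_{k-1}^2$. $W_\omega$ is subnormal iff there is a probability measure $\sigma$ on $[0,\|W_\omega\|^2]$ (its Berger measure) with $\gamma_k=\int r^kd\sigma(r)$ for all $k\ge0$. Non-flat means that no two consecutive weights are equal; for subnormal shifts this means that the weight sequence is strictly increasing, i.e. $W_\omega$ is not a positive multiple of the unweighted shift $U_+$ (weights $1,1,1,\dots$) or of $S_a$ (weights $a,1,1,\dots$ with $0<a<1$). A $2$-variable weighted shift $W_{(\alpha,\beta)}\equiv(T_1,T_2)$, with bounded positive weights $\alpha_{\mathbf k},\beta_{\mathbf k}$ ($\mathbf k\in\mathbb{Z}_+^2$), acts on $\ell^2(\mathbb{Z}_+^2)$ by $T_1e_{\mathbf k}=\alpha_{\mathbf k}e_{\mathbf k+(1,0)}$,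 $T_2e_{\mathbf k}=\beta_{\mathbf k}e_{\mathbf k+(0,1)}$, and is assumed commuting. Its moment $\gamma_{(k_1,k_2)}$ is the product of the squares of the weights along any nondecreasing lattice path from $(0,0)$ to $(k_1,k_2)$. For a closed interval $I\subseteq\mathbb{R}_+$ with $\operatorname{supp}\sigma\subseteq I$ and polynomials $p,q$ nonnegative on $I$ with $f=(p,q)$ injective on $I$, the polynomial embedding $\mathcal{PE}(\omega;f)$ is the $2$-variable weighted shift with moments $\gamma_{(k_1,k_2)}=\int_Ip(r)^{k_1}q(r)^{k_2}d\sigma(r)$. Here $I=[0,c]$, $p(r)=r$, $q(r)=c-r$. A commuting pair $(T_1,T_2)$ is spherically quasinormal if $T_1$ and $T_2$ both commute with $T_1^*T_1+T_2^*T_2$. *)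

theory Defs
  imports "HOL-Probability.Probability" "HOL-Computational_Algebra.Polynomial"
begin

section \<open>The complex Hilbert space of square-summable families\<close>

typedef 'a ell2 = "{x :: 'a \<Rightarrow> complex. (\<lambda>i. (cmod (x i))\<^sup>2) summable_on UNIV}"
  morphisms coord Abs_ell2
  by (rule exI[of _ "\<lambda>_. 0"]) simp

setup_lifting type_definition_ell2

lemma ell2_eqI: "(\<And>i. coord x i = coord y i) \<Longrightarrow> x = y"
  by (simp add: coord_inject[symmetric] fun_eq_iff)

lemma coord_summable: "(\<lambda>i. (cmod (coord x i))\<^sup>2) summable_on UNIV"
  using coord[of x] by simp

lemma square_summable_add:
  fixes x y :: "'a \<Rightarrow> complex"
  assumes "(\<lambda>i. (cmod (x i))\<^sup>2) summable_on UNIV" "(\<lambda>i. (cmod (y i))\<^sup>2) summable_on UNIV"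
  shows "(\<lambda>i. (cmod (x i + y i))\<^sup>2) summable_on UNIV"
proof (rule summable_on_comparison_test)
  show "(\<lambda>i. 2 * (cmod (x i))\<^sup>2 + 2 * (cmod (y i))\<^sup>2) summable_on UNIV"
    by (intro summable_on_add summable_on_cmult_right assms)
  show "(cmod (x i + y i))\<^sup>2 \<le> 2 * (cmod (x i))\<^sup>2 + 2 * (cmod (y i))\<^sup>2" for i
  proof -
    have "(cmod (x i + y i))\<^sup>2 \<le> (cmod (x i) + cmod (y i))\<^sup>2"
      by (intro power_mono norm_triangle_ineq norm_ge_zero)
    also have "\<dots> \<le> 2 * (cmod (x i))\<^sup>2 + 2 * (cmod (y i))\<^sup>2"
      using sum_squares_bound[of "cmod (x i)" "cmod (y i)"] by (simp add: power2_sum)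
    finally show ?thesis .
  qed
qed auto

lemma square_summable_scale:
  fixes x :: "'a \<Rightarrow> complex"
  assumes "(\<lambda>i. (cmod (x i))\<^sup>2) summable_on UNIV"
  shows "(\<lambda>i. (cmod (a * x i))\<^sup>2) summable_on UNIV"
  using summable_on_cmult_right[OF assms, of "(cmod a)\<^sup>2"]
  by (simp add: norm_mult power_mult_distrib)

lift_definition scaleC :: "complex \<Rightarrow> 'a ell2 \<Rightarrow> 'a ell2" (infixr "*\<^sub>C" 75)
  is "\<lambda>a x i. a * x i"
  by (rule square_summable_scale)

lift_definition basis_ell2 :: "'a \<Rightarrow> 'a ell2" is "\<lambda>k i. if i = k then 1 else 0"
proof -
  fix k :: 'a
  have "(\<lambda>i. (cmod (if i = k then 1 else 0))\<^sup>2) summable_on {k}"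
    by simp
  then show "(\<lambda>i. (cmod (if i = k then 1 else 0))\<^sup>2) summable_on UNIV"
    by (rule summable_on_cong_neutral[THEN iffD1, rotated -1]) auto
qed

definition cinner :: "'a ell2 \<Rightarrow> 'a ell2 \<Rightarrow> complex" where
  "cinner x y = (\<Sum>\<^sub>\<infinity>i. coord x i * cnj (coord y i))"

lemma cinner_summable: "(\<lambda>i. coord x i * cnj (coord y i)) summable_on UNIV"
proof (rule abs_summable_summable, rule summable_on_comparison_test)
  show "(\<lambda>i. (cmod (coord x i))\<^sup>2 + (cmod (coord y i))\<^sup>2) summable_on UNIV"
    by (intro summable_on_add coord_summable)
  show "cmod (coord x i * cnj (coord y i)) \<le> (cmod (coord x i))\<^sup>2 + (cmod (coord y i))\<^sup>2" for i
    using sum_squares_bound[of "cmod (coord x i)" "cmod (coord y i)"]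
      mult_nonneg_nonneg[OF norm_ge_zero norm_ge_zero, of "coord x i" "coord y i"]
    unfolding norm_mult complex_mod_cnj mult.assoc by linarith
qed auto

instantiation ell2 :: (type) real_vector
begin

lift_definition zero_ell2 :: "'a ell2" is "\<lambda>_. 0" by simp
lift_definition plus_ell2 :: "'a ell2 \<Rightarrow> 'a ell2 \<Rightarrow> 'a ell2" is "\<lambda>x y i. x i + y i"
  by (rule square_summable_add)
lift_definition uminus_ell2 :: "'a ell2 \<Rightarrow> 'a ell2" is "\<lambda>x i. - x i" by simp
lift_definition minus_ell2 :: "'a ell2 \<Rightarrow> 'a ell2 \<Rightarrow> 'a ell2" is "\<lambda>x y i. x i - y i"
  using square_summable_add[of _ "\<lambda>i. - _ i"] by simp
lift_definition scaleR_ell2 :: "real \<Rightarrow> 'a ell2 \<Rightarrow> 'a ell2" is "\<lambda>a x i. complex_of_real a * x i"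
  by (rule square_summable_scale)

instance
proof
  fix x y z :: "'a ell2" and a b :: real
  show "x + y + z = x + (y + z)" "x + y = y + x" "0 + x = x" "- x + x = 0" "x - y = x + - y"
    by (transfer; simp add: add_ac)+
  show "a *\<^sub>R (x + y) = a *\<^sub>R x + a *\<^sub>R y" "(a + b) *\<^sub>R x = a *\<^sub>R x + b *\<^sub>R x"
    "a *\<^sub>R b *\<^sub>R x = (a * b) *\<^sub>R x" "1 *\<^sub>R x = x"
    by (transfer; simp add: algebra_simps)+
qed

end

text \<open>The underlying real inner product space supplies the norm, \<^const>\<open>bounded_linear\<close> and
  \<^const>\<open>onorm\<close>; complex linearity and adjoints below refer to \<^const>\<open>scaleC\<close> and \<^const>\<open>cinner\<close>.\<close>

instantiation ell2 :: (type) real_inner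
begin

definition inner_ell2 :: "'a ell2 \<Rightarrow> 'a ell2 \<Rightarrow> real" where
  "inner_ell2 x y = Re (cinner x y)"
definition norm_ell2 :: "'a ell2 \<Rightarrow> real" where
  "norm_ell2 x = sqrt (inner x x)"
definition sgn_ell2 :: "'a ell2 \<Rightarrow> 'a ell2" where
  "sgn_ell2 x = x /\<^sub>R norm x"
definition dist_ell2 :: "'a ell2 \<Rightarrow> 'a ell2 \<Rightarrow> real" where
  "dist_ell2 x y = norm (x - y)"
definition uniformity_ell2 :: "('a ell2 \<times> 'a ell2) filter" where
  "uniformity_ell2 = (INF e\<in>{0<..}. principal {(x, y). dist x y < e})"
definition open_ell2 :: "'a ell2 set \<Rightarrow> bool" where
  "open_ell2 U \<longleftrightarrow> (\<forall>x\<in>U. eventually (\<lambda>(x', y). x' = x \<longrightarrow> y \<in> U) uniformity)"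

instance
proof
  fix x y z :: "'a ell2" and a b :: real
  show "sgn x = x /\<^sub>R norm x" by (rule sgn_ell2_def)
  show "dist x y = norm (x - y)" by (rule dist_ell2_def)
  show "uniformity = (INF e\<in>{0<..}. principal {(x, y :: 'a ell2). dist x y < e})"
    by (rule uniformity_ell2_def)
  show "open U \<longleftrightarrow> (\<forall>x\<in>U. eventually (\<lambda>(x', y). x' = x \<longrightarrow> y \<in> U) uniformity)"
    for U :: "'a ell2 set"
    by (rule open_ell2_def)
  have "cinner y x = cnj (cinner x y)"
    unfolding cinner_def infsum_cnj[symmetric] by (simp add: mult.commute)
  then show "inner x y = inner y x"
    by (simp add: inner_ell2_def)
  have "cinner (x + y) z = cinner x z + cinner y z"
    using infsum_add[OF cinner_summable[of x z] cinner_summable[of y z]]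
    by (simp add: cinner_def plus_ell2.rep_eq distrib_right)
  then show "inner (x + y) z = inner x z + inner y z"
    by (simp add: inner_ell2_def)
  have "cinner (a *\<^sub>R x) y = a * cinner x y"
    by (simp add: cinner_def scaleR_ell2.rep_eq mult.assoc infsum_cmult_right')
  then show "inner (a *\<^sub>R x) y = a * inner x y"
    by (simp add: inner_ell2_def)
  have eq: "inner x x = (\<Sum>\<^sub>\<infinity>i. (cmod (coord x i))\<^sup>2)"
  proof -
    have "inner x x = (\<Sum>\<^sub>\<infinity>i. Re (coord x i * cnj (coord x i)))"
      unfolding inner_ell2_def cinner_def by (rule infsum_Re[symmetric, OF cinner_summable])
    then show ?thesis
      by (simp add: complex_mult_cnj cmod_power2)
  qed
  show "0 \<le> inner x x"
    unfolding eq by (rule infsum_nonneg) simp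
  show "inner x x = 0 \<longleftrightarrow> x = 0"
  proof
    assume "inner x x = 0"
    then have "(cmod (coord x i))\<^sup>2 = 0" for i
      unfolding eq using nonneg_infsum_le_0D[OF _ coord_summable[of x], of i] by simp
    then show "x = 0"
      by (intro ell2_eqI) (simp add: zero_ell2.rep_eq)
  next
    assume "x = 0"
    then show "inner x x = 0"
      unfolding eq by (simp add: zero_ell2.rep_eq)
  qed
  show "norm x = sqrt (inner x x)" by (rule norm_ell2_def)
qed

end

lemma norm_ell2_sq: "(norm x)\<^sup>2 = (\<Sum>\<^sub>\<infinity>i. (cmod (coord x i))\<^sup>2)"
proof -
  have "(norm x)\<^sup>2 = (\<Sum>\<^sub>\<infinity>i. Re (coord x i * cnj (coord x i)))"
    unfolding power2_norm_eq_inner inner_ell2_def cinner_def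
    by (rule infsum_Re[symmetric, OF cinner_summable])
  then show ?thesis
    by (simp add: complex_mult_cnj cmod_power2)
qed


section \<open>Operators\<close>

definition bounded_op :: "('a ell2 \<Rightarrow> 'b ell2) \<Rightarrow> bool" where
  "bounded_op T \<longleftrightarrow> bounded_linear T \<and> (\<forall>a x. T (a *\<^sub>C x) = a *\<^sub>C T x)"

definition hadjoint :: "('a ell2 \<Rightarrow> 'b ell2) \<Rightarrow> 'b ell2 \<Rightarrow> 'a ell2" where
  "hadjoint T = (THE S. \<forall>x y. cinner (T x) y = cinner x (S y))"

lemma cinner_basis: "cinner (basis_ell2 k) x = cnj (coord x k)"
proof -
  have "cinner (basis_ell2 k) x = (\<Sum>\<^sub>\<infinity>i\<in>{k}. cnj (coord x i))"
    unfolding cinner_def by (rule infsum_cong_neutral) (auto simp: basis_ell2.rep_eq)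
  then show ?thesis by simp
qed

lemma hadjoint_eqI:
  assumes "\<And>x y. cinner (T x) y = cinner x (S y)"
  shows "hadjoint T = S"
  unfolding hadjoint_def
proof (rule the_equality)
  fix S' assume S': "\<forall>x y. cinner (T x) y = cinner x (S' y)"
  show "S' = S"
  proof
    fix y
    have "cinner x (S' y) = cinner x (S y)" for x
      using S' assms by metis
    from this[of "basis_ell2 _"] show "S' y = S y"
      by (intro ell2_eqI) (simp add: cinner_basis)
  qed
qed (use assms in blast)

definition spherically_quasinormal :: "('a ell2 \<Rightarrow> 'a ell2) \<Rightarrow> ('a ell2 \<Rightarrow> 'a ell2) \<Rightarrow> bool" where
  "spherically_quasinormal T\<^sub>1 T\<^sub>2 \<longleftrightarrow>
     bounded_op T\<^sub>1 \<and> bounded_op T\<^sub>2 \<and> T\<^sub>1 \<circ> T\<^sub>2 = T\<^sub>2 \<circ> T\<^sub>1 \<and>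
     (let P = (\<lambda>x. hadjoint T\<^sub>1 (T\<^sub>1 x) + hadjoint T\<^sub>2 (T\<^sub>2 x))
      in T\<^sub>1 \<circ> P = P \<circ> T\<^sub>1 \<and> T\<^sub>2 \<circ> P = P \<circ> T\<^sub>2)"


section \<open>Weighted shifts\<close>

text \<open>The operator determined by \<open>e\<^sub>k \<mapsto> w k \<cdot> e\<^bsub>s k\<^esub>\<close>, for \<open>s\<close> injective (so that the sum has at
  most one term) and \<open>w\<close> bounded; otherwise the family below need not be in the domain of
  \<^const>\<open>Abs_ell2\<close> and the value is unspecified.\<close>

definition shift_along :: "('a \<Rightarrow> 'a) \<Rightarrow> ('a \<Rightarrow> real) \<Rightarrow> 'a ell2 \<Rightarrow> 'a ell2" where
  "shift_along s w x = Abs_ell2 (\<lambda>k. \<Sum>j | s j = k. of_real (w j) * coord x j)"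

lemma
  assumes s: "inj s" and w: "bounded (range w)"
  shows coord_shift_along:
      "coord (shift_along s w x) k = (\<Sum>j | s j = k. of_real (w j) * coord x j)"
    and shift_along_basis: "shift_along s w (basis_ell2 j) = w j *\<^sub>R basis_ell2 (s j)"
    and bounded_op_shift_along: "bounded_op (shift_along s w)"
proof -
  obtain B where B: "\<And>j. \<bar>w j\<bar> \<le> B"
    using w by (auto simp: bounded_iff)
  define g where "g x k = (\<Sum>j | s j = k. complex_of_real (w j) * coord x j)" for x k
  have fib: "{j. s j = s i} = {i}" for i
    by (auto simp: inj_eq[OF s])
  have g_s: "g x (s j) = w j * coord x j" for x j
    by (simp add: g_def fib)
  have g_0: "g x k = 0" if "k \<notin> range s" for x k
  proof -
    have "{j. s j = k} = {}" using that by auto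
    then show ?thesis by (simp add: g_def)
  qed
  have bound: "(cmod (w j * coord x j))\<^sup>2 \<le> B\<^sup>2 * (cmod (coord x j))\<^sup>2" for x j
  proof -
    have "(w j)\<^sup>2 \<le> B\<^sup>2" using B[of j] by (metis abs_ge_zero power2_abs power_mono)
    then show ?thesis by (simp add: norm_mult power_mult_distrib mult_right_mono)
  qed
  have summ: "(\<lambda>j. (cmod (w j * coord x j))\<^sup>2) summable_on UNIV" for x
    by (rule summable_on_comparison_test[OF summable_on_cmult_right[OF coord_summable] bound]) auto
  have "(\<lambda>k. (cmod (g x k))\<^sup>2) summable_on range s" for x
    using summ[of x] by (subst summable_on_reindex[OF s]) (simp add: o_def g_s)
  then have mem: "(\<lambda>k. (cmod (g x k))\<^sup>2) summable_on UNIV" for x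
    by (rule summable_on_cong_neutral[THEN iffD1, rotated -1]) (auto simp: g_0)
  have c: "coord (shift_along s w x) = g x" for x
  proof -
    have "shift_along s w x = Abs_ell2 (g x)"
      unfolding shift_along_def g_def[abs_def] ..
    then show ?thesis
      using mem[of x] by (simp add: Abs_ell2_inverse)
  qed
  show "coord (shift_along s w x) k = (\<Sum>j | s j = k. of_real (w j) * coord x j)"
    by (simp add: c g_def)
  show "shift_along s w (basis_ell2 j) = w j *\<^sub>R basis_ell2 (s j)"
  proof (rule ell2_eqI)
    fix k
    show "coord (shift_along s w (basis_ell2 j)) k = coord (w j *\<^sub>R basis_ell2 (s j)) k"
    proof (cases "k \<in> range s")
      case True
      then show ?thesis
        by (auto simp: c g_s scaleR_ell2.rep_eq basis_ell2.rep_eq inj_eq[OF s])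
    next
      case False
      then have "k \<noteq> s j" by blast
      then show ?thesis
        using False by (simp add: c g_0 scaleR_ell2.rep_eq basis_ell2.rep_eq)
    qed
  qed
  have norm_le: "norm (shift_along s w x) \<le> norm x * \<bar>B\<bar>" for x
  proof -
    have "(norm (shift_along s w x))\<^sup>2 = (\<Sum>\<^sub>\<infinity>k\<in>range s. (cmod (g x k))\<^sup>2)"
      unfolding norm_ell2_sq c by (rule infsum_cong_neutral) (auto simp: g_0)
    also have "\<dots> = (\<Sum>\<^sub>\<infinity>j. (cmod (w j * coord x j))\<^sup>2)"
      by (subst infsum_reindex[OF s]) (simp add: o_def g_s)
    also have "\<dots> \<le> (\<Sum>\<^sub>\<infinity>j. B\<^sup>2 * (cmod (coord x j))\<^sup>2)"
      by (rule infsum_mono[OF summ summable_on_cmult_right[OF coord_summable] bound])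
    also have "\<dots> = (norm x * \<bar>B\<bar>)\<^sup>2"
      by (simp add: infsum_cmult_right' norm_ell2_sq power_mult_distrib mult.commute)
    finally show ?thesis by (rule power2_le_imp_le) simp
  qed
  show "bounded_op (shift_along s w)"
    unfolding bounded_op_def
  proof (intro conjI allI bounded_linear_intro[where K = "\<bar>B\<bar>"] norm_le)
    show "shift_along s w (x + y) = shift_along s w x + shift_along s w y" for x y
      by (rule ell2_eqI) (simp add: c g_def plus_ell2.rep_eq distrib_left sum.distrib)
    show "shift_along s w (r *\<^sub>R x) = r *\<^sub>R shift_along s w x" for r x
      by (rule ell2_eqI) (simp add: c g_def scaleR_ell2.rep_eq sum_distrib_left mult_ac)
    show "shift_along s w (a *\<^sub>C x) = a *\<^sub>C shift_along s w x" for a x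
      by (rule ell2_eqI) (simp add: c g_def scaleC.rep_eq sum_distrib_left mult_ac)
  qed
qed

definition bounded_positive :: "('a \<Rightarrow> real) \<Rightarrow> bool" where
  "bounded_positive w \<longleftrightarrow> (\<forall>k. 0 < w k) \<and> bounded (range w)"

definition weighted_shift :: "(nat \<Rightarrow> real) \<Rightarrow> nat ell2 \<Rightarrow> nat ell2" where
  "weighted_shift \<omega> = shift_along Suc \<omega>"

definition moment :: "(nat \<Rightarrow> real) \<Rightarrow> nat \<Rightarrow> real" where
  "moment \<omega> k = (\<Prod>i<k. (\<omega> i)\<^sup>2)"

definition non_flat :: "(nat \<Rightarrow> real) \<Rightarrow> bool" where
  "non_flat \<omega> \<longleftrightarrow> (\<forall>n. \<omega> n \<noteq> \<omega> (Suc n))"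

definition berger_measure :: "(nat \<Rightarrow> real) \<Rightarrow> real measure \<Rightarrow> bool" where
  "berger_measure \<omega> \<sigma> \<longleftrightarrow>
     prob_space \<sigma> \<and> sets \<sigma> = sets borel \<and>
     measure \<sigma> {0..(onorm (weighted_shift \<omega>))\<^sup>2} = 1 \<and>
     (\<forall>k. moment \<omega> k = (\<integral>r. r ^ k \<partial>\<sigma>))"

text \<open>Subnormality through Berger's theorem: the existence of a Berger measure.\<close>

definition subnormal_shift :: "(nat \<Rightarrow> real) \<Rightarrow> bool" where
  "subnormal_shift \<omega> \<longleftrightarrow> (\<exists>\<sigma>. berger_measure \<omega> \<sigma>)"


section \<open>2-variable weighted shifts\<close>

definition shift1 :: "(nat \<times> nat \<Rightarrow> real) \<Rightarrow> (nat \<times> nat) ell2 \<Rightarrow> (nat \<times> nat) ell2" where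
  "shift1 \<alpha> = shift_along (\<lambda>(i, j). (Suc i, j)) \<alpha>"

definition shift2 :: "(nat \<times> nat \<Rightarrow> real) \<Rightarrow> (nat \<times> nat) ell2 \<Rightarrow> (nat \<times> nat) ell2" where
  "shift2 \<beta> = shift_along (\<lambda>(i, j). (i, Suc j)) \<beta>"

definition two_variable_shift :: "(nat \<times> nat \<Rightarrow> real) \<Rightarrow> (nat \<times> nat \<Rightarrow> real) \<Rightarrow> bool" where
  "two_variable_shift \<alpha> \<beta> \<longleftrightarrow>
     bounded_positive \<alpha> \<and> bounded_positive \<beta> \<and> shift1 \<alpha> \<circ> shift2 \<beta> = shift2 \<beta> \<circ> shift1 \<alpha>"

text \<open>The path along the first axis followed by a vertical segment; for commuting shifts the
  recursions in the lemma below show that every nondecreasing lattice path gives the same value.\<close>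

definition moment2 :: "(nat \<times> nat \<Rightarrow> real) \<Rightarrow> (nat \<times> nat \<Rightarrow> real) \<Rightarrow> nat \<times> nat \<Rightarrow> real" where
  "moment2 \<alpha> \<beta> = (\<lambda>(k\<^sub>1, k\<^sub>2). (\<Prod>i<k\<^sub>1. (\<alpha> (i, 0))\<^sup>2) * (\<Prod>j<k\<^sub>2. (\<beta> (k\<^sub>1, j))\<^sup>2))"

lemma two_variable_shift_commute:
  assumes "two_variable_shift \<alpha> \<beta>"
  shows "\<beta> (i, j) * \<alpha> (i, Suc j) = \<alpha> (i, j) * \<beta> (Suc i, j)"
proof -
  have inj: "inj (\<lambda>(i, j). (Suc i, j :: nat))" "inj (\<lambda>(i :: nat, j). (i, Suc j))"
    by (auto simp: inj_def)
  have bdd: "bounded (range \<alpha>)" "bounded (range \<beta>)"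
    and comm: "shift1 \<alpha> \<circ> shift2 \<beta> = shift2 \<beta> \<circ> shift1 \<alpha>"
    using assms by (auto simp: two_variable_shift_def bounded_positive_def)
  have lin: "bounded_linear (shift1 \<alpha>)" "bounded_linear (shift2 \<beta>)"
    using bounded_op_shift_along[OF inj(1) bdd(1)] bounded_op_shift_along[OF inj(2) bdd(2)]
    by (auto simp: bounded_op_def shift1_def shift2_def)
  have b: "shift1 \<alpha> (basis_ell2 (a, b)) = \<alpha> (a, b) *\<^sub>R basis_ell2 (Suc a, b)"
    "shift2 \<beta> (basis_ell2 (a, b)) = \<beta> (a, b) *\<^sub>R basis_ell2 (a, Suc b)" for a b
    using shift_along_basis[OF inj(1) bdd(1), of "(a, b)"]
      shift_along_basis[OF inj(2) bdd(2), of "(a, b)"]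
    by (simp_all add: shift1_def shift2_def)
  have "(shift1 \<alpha> \<circ> shift2 \<beta>) (basis_ell2 (i, j)) = (shift2 \<beta> \<circ> shift1 \<alpha>) (basis_ell2 (i, j))"
    using comm by simp
  then have "(\<beta> (i, j) * \<alpha> (i, Suc j)) *\<^sub>R basis_ell2 (Suc i, Suc j) =
      (\<alpha> (i, j) * \<beta> (Suc i, j)) *\<^sub>R basis_ell2 (Suc i, Suc j)"
    by (simp add: b linear_scale[OF bounded_linear.linear[OF lin(1)]]
        linear_scale[OF bounded_linear.linear[OF lin(2)]])
  from arg_cong[OF this, of "\<lambda>x. coord x (Suc i, Suc j)"]
  show ?thesis
    by (simp add: scaleR_ell2.rep_eq basis_ell2.rep_eq flip: of_real_mult)
qed

lemma moment2_steps:
  assumes "two_variable_shift \<alpha> \<beta>"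
  shows "moment2 \<alpha> \<beta> (0, 0) = 1"
    and "moment2 \<alpha> \<beta> (Suc i, j) = (\<alpha> (i, j))\<^sup>2 * moment2 \<alpha> \<beta> (i, j)"
    and "moment2 \<alpha> \<beta> (i, Suc j) = (\<beta> (i, j))\<^sup>2 * moment2 \<alpha> \<beta> (i, j)"
proof -
  have V: "moment2 \<alpha> \<beta> (i, Suc j) = (\<beta> (i, j))\<^sup>2 * moment2 \<alpha> \<beta> (i, j)" for i j
    by (simp add: moment2_def)
  then show "moment2 \<alpha> \<beta> (i, Suc j) = (\<beta> (i, j))\<^sup>2 * moment2 \<alpha> \<beta> (i, j)" .
  show "moment2 \<alpha> \<beta> (0, 0) = 1"
    by (simp add: moment2_def)
  show "moment2 \<alpha> \<beta> (Suc i, j) = (\<alpha> (i, j))\<^sup>2 * moment2 \<alpha> \<beta> (i, j)"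
  proof (induction j)
    case 0
    show ?case by (simp add: moment2_def)
  next
    case (Suc j)
    have "moment2 \<alpha> \<beta> (Suc i, Suc j) = (\<alpha> (i, j) * \<beta> (Suc i, j))\<^sup>2 * moment2 \<alpha> \<beta> (i, j)"
      by (simp add: V Suc.IH power_mult_distrib)
    also have "\<dots> = (\<alpha> (i, Suc j))\<^sup>2 * moment2 \<alpha> \<beta> (i, Suc j)"
      by (simp add: V two_variable_shift_commute[OF assms, symmetric] power_mult_distrib)
    finally show ?case .
  qed
qed


section \<open>Polynomial embeddings\<close>

definition msupport :: "'a::topological_space measure \<Rightarrow> 'a set" where
  "msupport M = {x. \<forall>U. open U \<longrightarrow> x \<in> U \<longrightarrow> 0 < emeasure M U}"

definition polynomial_map :: "(real \<Rightarrow> real \<times> real) \<Rightarrow> bool" where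
  "polynomial_map f \<longleftrightarrow> (\<exists>p q :: real poly. f = (\<lambda>r. (poly p r, poly q r)))"

text \<open>\<open>(\<alpha>, \<beta>)\<close> are the weights of the embedding of the shift \<open>\<omega>\<close>, with Berger measure \<open>\<sigma>\<close>,
  by \<open>f = (p, q)\<close>. As weights are positive, the moments determine them.\<close>

definition polynomial_embedding ::
    "(nat \<Rightarrow> real) \<Rightarrow> real measure \<Rightarrow> real set \<Rightarrow> (real \<Rightarrow> real \<times> real) \<Rightarrow>
     (nat \<times> nat \<Rightarrow> real) \<Rightarrow> (nat \<times> nat \<Rightarrow> real) \<Rightarrow> bool" where
  "polynomial_embedding \<omega> \<sigma> I f \<alpha> \<beta> \<longleftrightarrow>
     bounded_positive \<omega> \<and> berger_measure \<omega> \<sigma> \<and>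
     is_interval I \<and> closed I \<and> I \<subseteq> {0..} \<and> msupport \<sigma> \<subseteq> I \<and>
     polynomial_map f \<and> (\<forall>r\<in>I. 0 \<le> fst (f r) \<and> 0 \<le> snd (f r)) \<and> inj_on f I \<and>
     two_variable_shift \<alpha> \<beta> \<and>
     (\<forall>k\<^sub>1 k\<^sub>2. moment2 \<alpha> \<beta> (k\<^sub>1, k\<^sub>2) = (LINT r:I|\<sigma>. fst (f r) ^ k\<^sub>1 * snd (f r) ^ k\<^sub>2))"

end

theory Submission
  imports Defs
begin

text \<open>The moments of the embedding are \<open>g (i, j) = \<integral> r\<^sup>i (c - r)\<^sup>j d\<sigma>(r)\<close> over \<open>[0, c]\<close>, and the squared
  weights have to be the quotients \<open>g (i + 1, j) / g (i, j)\<close> and \<open>g (i, j + 1) / g (i, j)\<close>. The two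
  components of \<open>f\<close> add up to \<open>c\<close>, so \<open>g (i + 1, j) + g (i, j + 1) = c g (i, j)\<close>, that is,
  \<open>\<alpha>\<^sup>2 + \<beta>\<^sup>2 = c\<close> at every lattice point. Since \<open>T\<^sup>*T\<close> is, for a weighted shift \<open>T\<close>, the diagonal
  operator of the squared weights, \<open>T\<^sub>1\<^sup>*T\<^sub>1 + T\<^sub>2\<^sup>*T\<^sub>2\<close> is \<open>c\<close> times the identity and commutes with
  everything (\<open>spherically_quasinormal_if_constant_square_sum\<close>).

  The same identity bounds both quotients by \<open>c\<close>. Hence the only obstacle to the existence of the
  embedding is that some \<open>g (i, j)\<close> might vanish. In that case \<open>\<sigma>\<close> lives on \<open>{0, c}\<close>, so that
  \<open>\<gamma>\<^sub>k\<^sub>+\<^sub>1 = c \<gamma>\<^sub>k\<close> for \<open>k \<ge> 1\<close>, which makes all weights \<open>\<omega>\<^sub>1, \<omega>\<^sub>2, \<dots>\<close> equal; non-flatness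
  excludes this (\<open>segment_moment_pos\<close>). Uniqueness holds because moments determine positive weights
  (\<open>moment2_determines_weights\<close>).\<close>

section \<open>Adjoints of shifts\<close>

lemma coord_shift_along_image:
  assumes "inj s" "bounded (range w)"
  shows "coord (shift_along s w x) (s j) = w j * coord x j"
proof -
  have "{i. s i = s j} = {j}" using assms(1) by (auto simp: inj_eq)
  then show ?thesis by (simp add: coord_shift_along[OF assms])
qed

lemma coord_shift_along_outside:
  assumes "inj s" "bounded (range w)" "k \<notin> range s"
  shows "coord (shift_along s w x) k = 0"
proof -
  have "{i. s i = k} = {}" using assms(3) by auto
  then show ?thesis by (simp add: coord_shift_along[OF assms(1,2)])
qed

definition backward_shift_along :: "('a \<Rightarrow> 'a) \<Rightarrow> ('a \<Rightarrow> real) \<Rightarrow> 'a ell2 \<Rightarrow> 'a ell2" where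
  "backward_shift_along s w y = Abs_ell2 (\<lambda>j. w j * coord y (s j))"

lemma coord_backward_shift_along:
  assumes s: "inj s" and w: "bounded (range w)"
  shows "coord (backward_shift_along s w y) j = w j * coord y (s j)"
proof -
  obtain B where B: "\<And>j. \<bar>w j\<bar> \<le> B"
    using w by (auto simp: bounded_iff)
  have "(\<lambda>k. (cmod (coord y k))\<^sup>2) summable_on range s"
    by (rule summable_on_subset_banach[OF coord_summable]) simp
  then have "(\<lambda>j. B\<^sup>2 * (cmod (coord y (s j)))\<^sup>2) summable_on UNIV"
    by (intro summable_on_cmult_right) (simp add: summable_on_reindex[OF s] o_def)
  then have "(\<lambda>j. (cmod (w j * coord y (s j)))\<^sup>2) summable_on UNIV"
  proof (rule summable_on_comparison_test)
    show "(cmod (w j * coord y (s j)))\<^sup>2 \<le> B\<^sup>2 * (cmod (coord y (s j)))\<^sup>2" for j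
    proof -
      have "(w j)\<^sup>2 \<le> B\<^sup>2" using B[of j] by (metis abs_ge_zero power2_abs power_mono)
      then show ?thesis by (simp add: norm_mult power_mult_distrib mult_right_mono)
    qed
  qed auto
  then show ?thesis
    by (simp add: backward_shift_along_def Abs_ell2_inverse)
qed

lemma hadjoint_shift_along:
  assumes s: "inj s" and w: "bounded (range w)"
  shows "hadjoint (shift_along s w) = backward_shift_along s w"
proof (rule hadjoint_eqI)
  fix x y
  have "cinner (shift_along s w x) y =
      (\<Sum>\<^sub>\<infinity>k\<in>range s. coord (shift_along s w x) k * cnj (coord y k))"
    unfolding cinner_def
    by (rule infsum_cong_neutral) (auto simp: coord_shift_along_outside[OF s w])
  also have "\<dots> = (\<Sum>\<^sub>\<infinity>j. w j * coord x j * cnj (coord y (s j)))"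
    by (subst infsum_reindex[OF s]) (simp add: o_def coord_shift_along_image[OF s w])
  also have "\<dots> = cinner x (backward_shift_along s w y)"
    unfolding cinner_def by (simp add: coord_backward_shift_along[OF s w] mult_ac)
  finally show "cinner (shift_along s w x) y = cinner x (backward_shift_along s w y)" .
qed

lemma coord_hadjoint_shift_along_self:
  assumes "inj s" "bounded (range w)"
  shows "coord (hadjoint (shift_along s w) (shift_along s w x)) j = (w j)\<^sup>2 * coord x j"
  by (simp add: hadjoint_shift_along[OF assms] coord_backward_shift_along[OF assms]
      coord_shift_along_image[OF assms] power2_eq_square)

section \<open>Two-variable shifts\<close>

lemma inj_lattice_steps:
  "inj (\<lambda>(i, j :: nat). (Suc i, j))" "inj (\<lambda>(i :: nat, j). (i, Suc j))"
  by (auto simp: inj_def)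

lemma coord_shift1:
  assumes "bounded (range \<alpha>)"
  shows "coord (shift1 \<alpha> x) (0, j) = 0"
    and "coord (shift1 \<alpha> x) (Suc i, j) = \<alpha> (i, j) * coord x (i, j)"
  using coord_shift_along_image[OF inj_lattice_steps(1) assms, of x "(i, j)"]
  by (auto simp: shift1_def intro!: coord_shift_along_outside[OF inj_lattice_steps(1) assms])

lemma coord_shift2:
  assumes "bounded (range \<beta>)"
  shows "coord (shift2 \<beta> x) (i, 0) = 0"
    and "coord (shift2 \<beta> x) (i, Suc j) = \<beta> (i, j) * coord x (i, j)"
  using coord_shift_along_image[OF inj_lattice_steps(2) assms, of x "(i, j)"]
  by (auto simp: shift2_def intro!: coord_shift_along_outside[OF inj_lattice_steps(2) assms])

lemma two_variable_shiftI:
  assumes \<alpha>: "bounded_positive \<alpha>" and \<beta>: "bounded_positive \<beta>"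
    and commute: "\<And>i j. \<beta> (i, j) * \<alpha> (i, Suc j) = \<alpha> (i, j) * \<beta> (Suc i, j)"
  shows "two_variable_shift \<alpha> \<beta>"
proof -
  have bdd: "bounded (range \<alpha>)" "bounded (range \<beta>)"
    using \<alpha> \<beta> by (auto simp: bounded_positive_def)
  have "shift1 \<alpha> (shift2 \<beta> x) = shift2 \<beta> (shift1 \<alpha> x)" for x
  proof (rule ell2_eqI)
    fix k :: "nat \<times> nat"
    obtain a b where k: "k = (a, b)" by fastforce
    show "coord (shift1 \<alpha> (shift2 \<beta> x)) k = coord (shift2 \<beta> (shift1 \<alpha> x)) k"
    proof (cases a; cases b)
      fix i j assume ab: "a = Suc i" "b = Suc j"
      have "complex_of_real (\<alpha> (i, Suc j)) * \<beta> (i, j) = \<beta> (Suc i, j) * \<alpha> (i, j)"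
        using commute[of i j] by (metis mult.commute of_real_mult)
      then show ?thesis
        by (simp add: k ab coord_shift1[OF bdd(1)] coord_shift2[OF bdd(2)] flip: mult.assoc)
    qed (simp_all add: k coord_shift1[OF bdd(1)] coord_shift2[OF bdd(2)])
  qed
  then show ?thesis
    using \<alpha> \<beta> by (auto simp: two_variable_shift_def fun_eq_iff)
qed

text \<open>Here \<open>T\<^sub>1\<^sup>*T\<^sub>1 + T\<^sub>2\<^sup>*T\<^sub>2\<close> is \<open>c\<close> times the identity: up to the factor \<open>\<surd>c\<close> the pair is a spherical
  isometry.\<close>

lemma spherically_quasinormal_if_constant_square_sum:
  assumes shift: "two_variable_shift \<alpha> \<beta>"
    and sum: "\<And>k. (\<alpha> k)\<^sup>2 + (\<beta> k)\<^sup>2 = c"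
  shows "spherically_quasinormal (shift1 \<alpha>) (shift2 \<beta>)"
proof -
  have bdd: "bounded (range \<alpha>)" "bounded (range \<beta>)"
    and commute: "shift1 \<alpha> \<circ> shift2 \<beta> = shift2 \<beta> \<circ> shift1 \<alpha>"
    using shift by (auto simp: two_variable_shift_def bounded_positive_def)
  have op: "bounded_op (shift1 \<alpha>)" "bounded_op (shift2 \<beta>)"
    using bounded_op_shift_along[OF inj_lattice_steps(1) bdd(1)]
      bounded_op_shift_along[OF inj_lattice_steps(2) bdd(2)]
    by (auto simp: shift1_def shift2_def)
  have "hadjoint (shift1 \<alpha>) (shift1 \<alpha> x) + hadjoint (shift2 \<beta>) (shift2 \<beta> x) = c *\<^sub>C x" for x
  proof (rule ell2_eqI)
    fix k
    have "complex_of_real c = (\<alpha> k)\<^sup>2 + (\<beta> k)\<^sup>2"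
      using sum[of k] by (metis of_real_add of_real_power)
    then show "coord (hadjoint (shift1 \<alpha>) (shift1 \<alpha> x) + hadjoint (shift2 \<beta>) (shift2 \<beta> x)) k =
        coord (c *\<^sub>C x) k"
      by (simp add: shift1_def shift2_def plus_ell2.rep_eq scaleC.rep_eq distrib_right
          coord_hadjoint_shift_along_self[OF inj_lattice_steps(1) bdd(1)]
          coord_hadjoint_shift_along_self[OF inj_lattice_steps(2) bdd(2)])
  qed
  then show ?thesis
    using op commute by (simp add: spherically_quasinormal_def bounded_op_def fun_eq_iff)
qed

lemma two_variable_shift_weights_pos:
  assumes "two_variable_shift \<alpha> \<beta>"
  shows "0 < \<alpha> k" "0 < \<beta> k"
  using assms unfolding two_variable_shift_def bounded_positive_def by blast+

lemma moment2_pos: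
  assumes "two_variable_shift \<alpha> \<beta>"
  shows "0 < moment2 \<alpha> \<beta> k"
proof -
  have "\<alpha> k \<noteq> 0" "\<beta> k \<noteq> 0" for k
    using two_variable_shift_weights_pos[OF assms, of k] by auto
  then show ?thesis
    by (auto simp: moment2_def split: prod.split intro!: mult_pos_pos prod_pos)
qed

lemma moment2_determines_weights:
  assumes shift: "two_variable_shift \<alpha> \<beta>" and shift': "two_variable_shift \<alpha>' \<beta>'"
    and eq: "moment2 \<alpha> \<beta> = moment2 \<alpha>' \<beta>'"
  shows "\<alpha> = \<alpha>'" "\<beta> = \<beta>'"
proof -
  have pos: "0 \<le> \<alpha> k" "0 \<le> \<alpha>' k" "0 \<le> \<beta> k" "0 \<le> \<beta>' k" for k
    using two_variable_shift_weights_pos[OF shift, of k] two_variable_shift_weights_pos[OF shift', of k]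
    by auto
  have "(\<alpha> (i, j))\<^sup>2 = (\<alpha>' (i, j))\<^sup>2" "(\<beta> (i, j))\<^sup>2 = (\<beta>' (i, j))\<^sup>2" for i j
    using moment2_steps(2,3)[OF shift, of i j] moment2_steps(2,3)[OF shift', of i j]
      moment2_pos[OF shift, of "(i, j)"]
    by (simp_all add: eq)
  then show "\<alpha> = \<alpha>'" "\<beta> = \<beta>'"
    using pos by (auto simp: fun_eq_iff intro: power2_eq_imp_eq)
qed

text \<open>Taking the square roots of the quotients of neighbouring moments as weights makes the pair
  commute: along both paths around a unit square the product of the squared weights telescopes to
  the quotient of the moments at opposite corners. The growth condition bounds the weights.\<close>

lemma two_variable_shift_with_moments_exists:
  fixes g :: "nat \<times> nat \<Rightarrow> real"
  assumes pos: "\<And>k. 0 < g k" and one: "g (0, 0) = 1"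
    and growth: "\<And>i j. g (Suc i, j) \<le> c * g (i, j)" "\<And>i j. g (i, Suc j) \<le> c * g (i, j)"
  obtains \<alpha> \<beta> where "two_variable_shift \<alpha> \<beta>" "moment2 \<alpha> \<beta> = g"
proof -
  define \<alpha> where "\<alpha> = (\<lambda>(i, j). sqrt (g (Suc i, j) / g (i, j)))"
  define \<beta> where "\<beta> = (\<lambda>(i, j). sqrt (g (i, Suc j) / g (i, j)))"
  have [simp]: "g k \<noteq> 0" "0 \<le> g k" for k
    using pos[of k] by auto
  have le: "\<bar>\<alpha> k\<bar> \<le> sqrt c" "\<bar>\<beta> k\<bar> \<le> sqrt c" for k
    using growth pos by (auto simp: \<alpha>_def \<beta>_def pos_divide_le_eq split: prod.split)
  have bp: "bounded_positive \<alpha>" "bounded_positive \<beta>"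
    using pos le unfolding bounded_positive_def bounded_iff
    by (auto simp: \<alpha>_def \<beta>_def intro!: exI[of _ "sqrt c"])
  have shift: "two_variable_shift \<alpha> \<beta>"
    by (rule two_variable_shiftI[OF bp])
      (simp add: \<alpha>_def \<beta>_def flip: real_sqrt_mult)
  have step: "(\<alpha> (i, j))\<^sup>2 * g (i, j) = g (Suc i, j)" "(\<beta> (i, j))\<^sup>2 * g (i, j) = g (i, Suc j)" for i j
    by (simp_all add: \<alpha>_def \<beta>_def)
  have "moment2 \<alpha> \<beta> (i, 0) = g (i, 0)" for i
    by (induction i) (simp_all only: moment2_steps[OF shift] one step)
  then have "moment2 \<alpha> \<beta> (i, j) = g (i, j)" for i j
    by (induction j) (simp_all only: moment2_steps[OF shift] step)
  then show thesis
    using that[OF shift] by (auto simp: fun_eq_iff)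
qed

section \<open>Moments on the segment from (0, c) to (c, 0)\<close>

definition segment_moment :: "real measure \<Rightarrow> real \<Rightarrow> nat \<times> nat \<Rightarrow> real" where
  "segment_moment \<sigma> c = (\<lambda>(i, j). LINT r:{0..c}|\<sigma>. r ^ i * (c - r) ^ j)"

lemma set_integrable_segment_monomial:
  fixes \<sigma> :: "real measure"
  assumes "finite_measure \<sigma>" "sets \<sigma> = sets borel"
  shows "set_integrable \<sigma> {0..c} (\<lambda>r. r ^ i * (c - r) ^ j)"
proof -
  interpret finite_measure \<sigma> by fact
  note assms(2)[measurable_cong]
  have "\<bar>r ^ i * (c - r) ^ j\<bar> \<le> c ^ i * c ^ j" if "0 \<le> r" "r \<le> c" for r
    using that by (auto simp: abs_mult intro!: mult_mono power_mono)
  then show ?thesis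
    unfolding set_integrable_def
    by (intro integrable_const_bound[where B = "\<bar>c ^ i * c ^ j\<bar>"])
      (auto split: split_indicator intro: order_trans)
qed

lemma segment_moment_nonneg: "0 \<le> segment_moment \<sigma> c k"
  by (auto simp: segment_moment_def set_lebesgue_integral_def split: prod.split split_indicator
      intro!: integral_nonneg_AE)

text \<open>This is \<open>r + (c - r) = c\<close> under the integral.\<close>

lemma segment_moment_sum:
  assumes "finite_measure \<sigma>" "sets \<sigma> = sets borel"
  shows "segment_moment \<sigma> c (Suc i, j) + segment_moment \<sigma> c (i, Suc j) = c * segment_moment \<sigma> c (i, j)"
proof -
  have "segment_moment \<sigma> c (Suc i, j) + segment_moment \<sigma> c (i, Suc j) =
      (LINT r:{0..c}|\<sigma>. r ^ Suc i * (c - r) ^ j + r ^ i * (c - r) ^ Suc j)"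
    unfolding segment_moment_def prod.case
    by (intro set_integral_add(2)[symmetric] set_integrable_segment_monomial assms)
  also have "\<dots> = (LINT r:{0..c}|\<sigma>. c * (r ^ i * (c - r) ^ j))"
    by (simp add: algebra_simps)
  finally show ?thesis
    by (simp add: segment_moment_def)
qed

text \<open>On \<open>[0, c]\<close> the integrand is nonnegative, and it has no zeros other than the end points.\<close>

lemma segment_moment_zero_imp_AE_endpoints:
  assumes fin: "finite_measure \<sigma>" and sets: "sets \<sigma> = sets borel"
    and supp: "AE r in \<sigma>. r \<in> {0..c}" and zero: "segment_moment \<sigma> c (i, j) = 0"
  shows "AE r in \<sigma>. r = 0 \<or> r = c"
proof -
  have "AE r in \<sigma>. indicator {0..c} r *\<^sub>R (r ^ i * (c - r) ^ j) = 0"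
    using zero set_integrable_segment_monomial[OF fin sets, of c i j]
    unfolding segment_moment_def prod.case set_lebesgue_integral_def set_integrable_def
    by (subst (asm) integral_nonneg_eq_0_iff_AE) (auto split: split_indicator)
  with supp show ?thesis
    by eventually_elim auto
qed

lemma berger_measure_AE:
  assumes "berger_measure \<omega> \<sigma>"
  shows "AE r in \<sigma>. r \<in> {0..(onorm (weighted_shift \<omega>))\<^sup>2}"
proof -
  interpret prob_space \<sigma>
    using assms by (simp add: berger_measure_def)
  show ?thesis
    using assms prob_eq_1[of "{0..(onorm (weighted_shift \<omega>))\<^sup>2}"] by (simp add: berger_measure_def)
qed

lemma segment_moment_pos:
  assumes \<omega>: "bounded_positive \<omega>" "non_flat \<omega>" and \<sigma>: "berger_measure \<omega> \<sigma>"
    and supp: "AE r in \<sigma>. r \<in> {0..c}"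
  shows "0 < segment_moment \<sigma> c k"
proof (rule ccontr)
  interpret prob_space \<sigma>
    using \<sigma> by (simp add: berger_measure_def)
  have sets: "sets \<sigma> = sets borel" and moments: "\<And>k. moment \<omega> k = (\<integral>r. r ^ k \<partial>\<sigma>)"
    using \<sigma> by (auto simp: berger_measure_def)
  note sets[measurable_cong]
  assume "\<not> 0 < segment_moment \<sigma> c k"
  then have "segment_moment \<sigma> c (fst k, snd k) = 0"
    using segment_moment_nonneg[of \<sigma> c k] by simp
  then have ends: "AE r in \<sigma>. r = 0 \<or> r = c"
    by (rule segment_moment_zero_imp_AE_endpoints[OF finite_measure_axioms sets supp])
  \<comment> \<open>A possible atom at \<open>0\<close> does not contribute to the moments of positive order, and therefore
    only \<open>\<omega> 0\<close> can differ from the other weights.\<close>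
  have geometric: "moment \<omega> (Suc (Suc n)) = c * moment \<omega> (Suc n)" for n
  proof -
    have "(\<integral>r. r ^ Suc (Suc n) \<partial>\<sigma>) = (\<integral>r. c * r ^ Suc n \<partial>\<sigma>)"
      using ends by (intro integral_cong_AE) auto
    then show ?thesis by (simp only: moments integral_mult_right_zero)
  qed
  have pos: "0 < \<omega> n" for n
    using \<omega>(1) by (simp add: bounded_positive_def)
  have moment_pos: "0 < moment \<omega> n" for n
    unfolding moment_def using pos by (intro prod_pos) (simp add: less_imp_neq[symmetric])
  have moment_Suc: "moment \<omega> (Suc n) = moment \<omega> n * (\<omega> n)\<^sup>2" for n
    by (simp add: moment_def)
  have "(\<omega> (Suc n))\<^sup>2 = c" for n
    using geometric[of n] moment_pos[of "Suc n"] moment_Suc[of "Suc n"] by simp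
  then have "(\<omega> 1)\<^sup>2 = (\<omega> 2)\<^sup>2"
    by (simp add: numeral_2_eq_2)
  then have "\<omega> 1 = \<omega> 2"
    by (rule power2_eq_imp_eq) (simp_all add: pos less_imp_le)
  with \<omega>(2) show False
    by (auto simp: non_flat_def numeral_2_eq_2)
qed

lemma msupport_subset_closed:
  assumes "closed I" "AE r in \<sigma>. r \<in> I" "sets \<sigma> = sets borel"
  shows "msupport \<sigma> \<subseteq> I"
proof
  fix x assume x: "x \<in> msupport \<sigma>"
  have "- I \<in> sets \<sigma>"
    using assms(1,3) by auto
  then have "emeasure \<sigma> (- I) = 0"
    using AE_E2[OF assms(2)] assms(3) sets_eq_imp_space_eq[OF assms(3)]
    by (simp add: Compl_eq)
  then show "x \<in> I"
    using x assms(1) unfolding msupport_def by (force simp: open_Compl)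
qed

section \<open>The embedding\<close>

theorem theorem3p5:
  fixes \<omega> :: "nat \<Rightarrow> real" and \<sigma> :: "real measure" and c :: real
    and f :: "real \<Rightarrow> real \<times> real" and \<mu> :: "(real \<times> real) measure"
  assumes "bounded_positive \<omega>" and "non_flat \<omega>" and "subnormal_shift \<omega>"
    and "berger_measure \<omega> \<sigma>"
    and "c = (onorm (weighted_shift \<omega>))\<^sup>2"
    and "f = (\<lambda>r. (r, c - r))"
    and "\<mu> = distr \<sigma> borel f"
  shows "(\<exists>!(\<alpha>, \<beta>). polynomial_embedding \<omega> \<sigma> {0..c} f \<alpha> \<beta>) \<and>
    (\<forall>\<alpha> \<beta>. polynomial_embedding \<omega> \<sigma> {0..c} f \<alpha> \<beta> \<longrightarrow>
       spherically_quasinormal (shift1 \<alpha>) (shift2 \<beta>))"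
proof -
  define g where "g = segment_moment \<sigma> c"
  have prob: "prob_space \<sigma>" and sets: "sets \<sigma> = sets borel"
    using assms(4) by (auto simp: berger_measure_def)
  interpret prob_space \<sigma> by (rule prob)
  have supp: "AE r in \<sigma>. r \<in> {0..c}"
    using berger_measure_AE[OF assms(4)] by (simp add: assms(5))
  have g_pos: "0 < g k" for k
    unfolding g_def by (rule segment_moment_pos[OF assms(1,2,4) supp])
  have g_sum: "g (Suc i, j) + g (i, Suc j) = c * g (i, j)" for i j
    unfolding g_def by (rule segment_moment_sum[OF finite_measure_axioms sets])
  have g_one: "g (0, 0) = 1"
    using assms(4) by (simp add: g_def segment_moment_def set_lebesgue_integral_def sets
        sets_eq_imp_space_eq[OF sets] berger_measure_def assms(5))
  have "polynomial_map f"
    unfolding polynomial_map_def assms(6)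
    by (intro exI[of _ "[:0, 1:]"] exI[of _ "[:c, -1:]"]) simp
  moreover have "msupport \<sigma> \<subseteq> {0..c}"
    by (rule msupport_subset_closed[OF _ supp sets]) simp
  ultimately have embedding_iff: "polynomial_embedding \<omega> \<sigma> {0..c} f \<alpha> \<beta> \<longleftrightarrow>
      two_variable_shift \<alpha> \<beta> \<and> moment2 \<alpha> \<beta> = g" for \<alpha> \<beta>
    using assms(1,4)
    by (auto simp: polynomial_embedding_def assms(6) g_def segment_moment_def fun_eq_iff inj_on_def)
  have growth: "g (Suc i, j) \<le> c * g (i, j)" "g (i, Suc j) \<le> c * g (i, j)" for i j
    using g_sum[of i j] g_pos[of "(Suc i, j)"] g_pos[of "(i, Suc j)"] by linarith+
  obtain \<alpha> \<beta> where \<alpha>\<beta>: "two_variable_shift \<alpha> \<beta>" "moment2 \<alpha> \<beta> = g"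
    by (rule two_variable_shift_with_moments_exists[OF g_pos g_one growth])
  have "\<exists>!(\<alpha>, \<beta>). polynomial_embedding \<omega> \<sigma> {0..c} f \<alpha> \<beta>"
  proof (rule ex1I[of _ "(\<alpha>, \<beta>)"])
    fix w assume "case w of (\<alpha>, \<beta>) \<Rightarrow> polynomial_embedding \<omega> \<sigma> {0..c} f \<alpha> \<beta>"
    then show "w = (\<alpha>, \<beta>)"
      using moment2_determines_weights[OF _ \<alpha>\<beta>(1)] \<alpha>\<beta>(2) by (cases w) (auto simp: embedding_iff)
  qed (simp add: embedding_iff \<alpha>\<beta>)
  moreover have "spherically_quasinormal (shift1 \<alpha>) (shift2 \<beta>)"
    if "polynomial_embedding \<omega> \<sigma> {0..c} f \<alpha> \<beta>" for \<alpha> \<beta>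
  proof (rule spherically_quasinormal_if_constant_square_sum)
    have shift: "two_variable_shift \<alpha> \<beta>" and g: "moment2 \<alpha> \<beta> = g"
      using that by (auto simp: embedding_iff)
    show "two_variable_shift \<alpha> \<beta>" by fact
    fix k :: "nat \<times> nat"
    obtain i j where k: "k = (i, j)" by fastforce
    have "((\<alpha> k)\<^sup>2 + (\<beta> k)\<^sup>2) * g k = c * g k"
      using g_sum[of i j] moment2_steps(2,3)[OF shift, of i j] by (simp add: k g distrib_right)
    then show "(\<alpha> k)\<^sup>2 + (\<beta> k)\<^sup>2 = c"
      using g_pos[of k] by simp
  qed
  ultimately show ?thesis by blast
qed

end
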